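(* Let $G$ be a nice graph. Then, for every set $W$ of $|E(G)|+2\Delta(G)$ distinct strictly positive integers, there exists an edge-injective neighbour-sum-distinguishing $W$-edge-weighting of $G$. In particular, $\chi^{e,1}_\Sigma(G)\leq |E(G)|+2\Delta(G)$.
   Context: All graphs are finite, simple, undirected and loopless; $\Delta(G)$ is the maximum degree. A graph is nice if none of its connected components is isomorphic to $K_2$. For a set $W$ of weights, a $W$-edge-weighting of $G$ is a map $w:E(G)\to W$; a $k$-edge-weighting is a $\{1,\dots,k\}$-edge-weighting. For a vertex $v$, $\sigma_w(v)=\sum_{u\in N(v)} w(vu)$. The weighting $w$ is neighbour-sum-distinguishing if $\sigma_w(u)\neq\sigma_w(v)$ for every edge $uv$, and edge-injective if no two distinct edges receive the same weight. For a nice graph $G$, $\chi^{e,1}_\Sigma(G)$ is the smallest $k$ such that $G$ admits an edge-injective neighbour-sum-distinguishing $k$-edge-weighting. *)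

theory Defs
  imports Main
begin

text \<open>A graph is given by its vertex set \<open>V\<close> and its edge set \<open>E\<close>, whose members are
  two-element subsets of \<open>V\<close>; the edge \<open>uv\<close> is \<open>{u, v}\<close>.\<close>

definition simple_graph :: "'a set \<Rightarrow> 'a set set \<Rightarrow> bool" where
  "simple_graph V E \<longleftrightarrow> finite V \<and> (\<forall>e\<in>E. e \<subseteq> V \<and> card e = 2)"

definition neighbours :: "'a set set \<Rightarrow> 'a \<Rightarrow> 'a set" where
  "neighbours E v = {u. {v, u} \<in> E}"

definition degree :: "'a set set \<Rightarrow> 'a \<Rightarrow> nat" where
  "degree E v = card (neighbours E v)"

text \<open>Inserting \<open>0\<close> only matters for the graph without vertices, whose maximum degree is thereby \<open>0\<close>.\<close>

definition max_degree :: "'a set \<Rightarrow> 'a set set \<Rightarrow> nat" where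
  "max_degree V E = Max (insert 0 (degree E ` V))"

definition connected_components :: "'a set \<Rightarrow> 'a set set \<Rightarrow> 'a set set" where
  "connected_components V E = (\<lambda>v. {u \<in> V. (v, u) \<in> {(x, y). {x, y} \<in> E}\<^sup>*}) ` V"

definition induced_edges :: "'a set set \<Rightarrow> 'a set \<Rightarrow> 'a set set" where
  "induced_edges E C = {e \<in> E. e \<subseteq> C}"

definition graph_isomorphic ::
    "'a set \<Rightarrow> 'a set set \<Rightarrow> 'b set \<Rightarrow> 'b set set \<Rightarrow> bool" where
  "graph_isomorphic V E V' E' \<longleftrightarrow>
     (\<exists>f. bij_betw f V V' \<and> (\<forall>x\<in>V. \<forall>y\<in>V. {x, y} \<in> E \<longleftrightarrow> {f x, f y} \<in> E'))"

definition complete_edges :: "'a set \<Rightarrow> 'a set set" where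
  "complete_edges A = {e. e \<subseteq> A \<and> card e = 2}"

definition nice :: "'a set \<Rightarrow> 'a set set \<Rightarrow> bool" where
  "nice V E \<longleftrightarrow>
     (\<forall>C \<in> connected_components V E.
        \<not> graph_isomorphic C (induced_edges E C) {..<2::nat} (complete_edges {..<2::nat}))"

text \<open>Only the values of \<open>w\<close> on \<open>E\<close> are relevant in the following notions.\<close>

definition edge_weighting :: "'a set set \<Rightarrow> int set \<Rightarrow> ('a set \<Rightarrow> int) \<Rightarrow> bool" where
  "edge_weighting E W w \<longleftrightarrow> (\<forall>e\<in>E. w e \<in> W)"

definition weight_sum :: "'a set set \<Rightarrow> ('a set \<Rightarrow> int) \<Rightarrow> 'a \<Rightarrow> int" where
  "weight_sum E w v = (\<Sum>u\<in>neighbours E v. w {v, u})"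

definition neighbour_sum_distinguishing :: "'a set set \<Rightarrow> ('a set \<Rightarrow> int) \<Rightarrow> bool" where
  "neighbour_sum_distinguishing E w \<longleftrightarrow>
     (\<forall>u v. {u, v} \<in> E \<longrightarrow> weight_sum E w u \<noteq> weight_sum E w v)"

definition edge_injective :: "'a set set \<Rightarrow> ('a set \<Rightarrow> int) \<Rightarrow> bool" where
  "edge_injective E w \<longleftrightarrow> inj_on w E"

definition chi_e1_Sigma :: "'a set set \<Rightarrow> nat" where
  "chi_e1_Sigma E =
     (LEAST k. \<exists>w. edge_weighting E {1..int k} w \<and> edge_injective E w \<and>
                   neighbour_sum_distinguishing E w)"

end

theory Submission
  imports Defs
begin

text \<open>Whether an edge \<open>xy\<close> is in conflict (equal sums at \<open>x\<close> and \<open>y\<close>) does not depend on the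
  weight of \<open>xy\<close> itself, only on the edges adjacent to it. So weight the edges greedily, in any
  order, keeping every edge of \<open>G\<close> (weighted or not) that is adjacent to a weighted edge free of
  conflict. Weighting \<open>uv\<close> changes the status of the edges adjacent to \<open>uv\<close> only; each of them
  excludes one value, so besides the fewer than \<open>|E|\<close> weights already used, at most \<open>2\<Delta>\<close> values
  are forbidden. In a nice graph every edge has an adjacent edge, so in the end no conflict is
  left.\<close>

lemma simple_graph_finite_edges:
  assumes "simple_graph V E"
  shows "finite E"
  using assms by (auto simp: simple_graph_def intro: finite_subset[of E "Pow V"])

lemma simple_graph_finite_neighbours:
  assumes "simple_graph V E"
  shows "finite (neighbours E v)"
proof (rule finite_subset)
  show "neighbours E v \<subseteq> V" and "finite V"
    using assms by (auto simp: simple_graph_def neighbours_def)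
qed

lemma degree_le_max_degree:
  assumes "simple_graph V E" and "v \<in> V"
  shows "degree E v \<le> max_degree V E"
  using assms by (auto simp: max_degree_def simple_graph_def)

text \<open>Since \<open>e\<close> is new, its other end is not yet a neighbour of \<open>x\<close>,
  so the sum at \<open>x\<close> gains exactly one summand, and changing \<open>w\<close> at
  \<open>e\<close> leaves the old ones alone.\<close>

lemma weight_sum_insert:
  assumes "card e = 2" and "e \<notin> A" and "finite (neighbours A x)"
  shows "weight_sum (insert e A) (w(e := a)) x = weight_sum A w x + (if x \<in> e then a else 0)"
proof -
  have old: "(\<Sum>u\<in>neighbours A x. (w(e := a)) {x, u}) = (\<Sum>u\<in>neighbours A x. w {x, u})"
    using \<open>e \<notin> A\<close> by (intro sum.cong) (auto simp: neighbours_def)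
  show ?thesis
  proof (cases "x \<in> e")
    case True
    with \<open>card e = 2\<close> obtain y where e: "e = {x, y}"
      by (auto simp: card_2_iff doubleton_eq_iff)
    then have "neighbours (insert e A) x = insert y (neighbours A x)"
      and "y \<notin> neighbours A x"
      using \<open>e \<notin> A\<close> by (auto simp: neighbours_def doubleton_eq_iff)
    then show ?thesis
      using assms(3) old True e by (simp add: weight_sum_def)
  next
    case False
    then have "neighbours (insert e A) x = neighbours A x"
      by (auto simp: neighbours_def)
    then show ?thesis
      using old False by (simp add: weight_sum_def)
  qed
qed

text \<open>Otherwise the edge would be a whole connected component, a copy of the complete graph on
  two vertices.\<close>

lemma nice_adjacent_edge:
  assumes "simple_graph V E" and "nice V E" and "{u, v} \<in> E"
  obtains g where "g \<in> E" "g \<noteq> {u, v}" "g \<inter> {u, v} \<noteq> {}"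
proof (rule ccontr)
  assume "\<not> thesis"
  with that have isolated: "g = {u, v}" if "g \<in> E" "g \<inter> {u, v} \<noteq> {}" for g
    using that by blast
  from assms have uv: "u \<in> V" "v \<in> V" "u \<noteq> v"
    by (auto simp: simple_graph_def dest!: bspec)
  let ?R = "{(x, y). {x, y} \<in> E}"
  have "y \<in> {u, v}" if "(u, y) \<in> ?R\<^sup>*" for y
    using that
  proof induction
    \<comment> \<open>The last edge of the walk meets \<open>{u, v}\<close> in \<open>y\<close>, so
      by isolation it is \<open>{u, v}\<close> itself.\<close>
    case (step y z)
    then have "{y, z} = {u, v}"
      by (intro isolated) auto
    then show ?case by blast
  qed simp
  moreover have "(u, v) \<in> ?R\<^sup>*"
    using assms(3) by blast
  ultimately have "{y \<in> V. (u, y) \<in> ?R\<^sup>*} = {u, v}"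
    using uv by blast
  then have "{u, v} \<in> connected_components V E"
    using uv by (auto simp: connected_components_def)
  moreover have "graph_isomorphic {u, v} (induced_edges E {u, v}) {..<2::nat} (complete_edges {..<2::nat})"
  proof -
    let ?f = "\<lambda>x. if x = u then 0 else 1 :: nat"
    have "bij_betw ?f {u, v} {..<2}"
      using uv by (auto simp: bij_betw_def inj_on_def lessThan_nat_numeral lessThan_Suc)
    \<comment> \<open>\<open>graph_isomorphic\<close> also compares pairs with x = y, where both
      sides must be non-edges.\<close>
    moreover have "{x, x} \<notin> E" for x
      using assms(1) by (auto simp: simple_graph_def dest!: bspec)
    then have "\<forall>x\<in>{u, v}. \<forall>y\<in>{u, v}.
        {x, y} \<in> induced_edges E {u, v} \<longleftrightarrow> {?f x, ?f y} \<in> complete_edges {..<2}"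
      using uv assms(3) by (auto simp: induced_edges_def complete_edges_def insert_commute)
    ultimately show ?thesis
      unfolding graph_isomorphic_def by blast
  qed
  ultimately show False
    using \<open>nice V E\<close> by (auto simp: nice_def)
qed

lemma greedy_edge_weighting:
  fixes W :: "int set"
  assumes G: "simple_graph V E"
    and W: "finite W" "card E + 2 * max_degree V E \<le> card W"
    and "A \<subseteq> E"
  shows "\<exists>w. edge_weighting A W w \<and> edge_injective A w \<and>
    (\<forall>x y. {x, y} \<in> E \<longrightarrow> (\<exists>g\<in>A. g \<noteq> {x, y} \<and> g \<inter> {x, y} \<noteq> {}) \<longrightarrow>
       weight_sum A w x \<noteq> weight_sum A w y)"
  using finite_subset[OF \<open>A \<subseteq> E\<close> simple_graph_finite_edges[OF G]] \<open>A \<subseteq> E\<close>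
proof (induction A rule: finite_induct)
  case empty
  show ?case by (simp add: edge_weighting_def edge_injective_def)
next
  case (insert e A)
  then obtain w where w: "edge_weighting A W w" "edge_injective A w"
    and IH: "\<And>x y g. {x, y} \<in> E \<Longrightarrow> g \<in> A \<Longrightarrow> g \<noteq> {x, y} \<Longrightarrow> g \<inter> {x, y} \<noteq> {} \<Longrightarrow>
      weight_sum A w x \<noteq> weight_sum A w y"
    by (metis insert_subset)
  let ?s = "weight_sum A w"
  have "e \<in> E" using insert.prems by blast
  with G have e2: "card e = 2" "e \<subseteq> V" by (auto simp: simple_graph_def)
  then obtain u v where e: "e = {u, v}" "u \<noteq> v" by (auto simp: card_2_iff)
  \<comment> \<open>After weighting, an edge zx with only z in \<open>e\<close> compares
    \<open>?s z + a\<close> with \<open>?s x\<close>; \<open>F z\<close> collects the values of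
    \<open>a\<close> that make these equal. Neighbours are taken in \<open>E\<close>, since
    unweighted edges must be protected too.\<close>
  define F where "F = (\<lambda>z. (\<lambda>x. ?s x - ?s z) ` neighbours E z)"
  have F: "finite (F z)" "z \<in> V \<Longrightarrow> card (F z) \<le> max_degree V E" for z
  proof -
    show "finite (F z)"
      using simple_graph_finite_neighbours[OF G] by (simp add: F_def)
    assume "z \<in> V"
    have "card (F z) \<le> degree E z"
      unfolding F_def degree_def by (intro card_image_le simple_graph_finite_neighbours[OF G])
    also note degree_le_max_degree[OF G \<open>z \<in> V\<close>]
    finally show "card (F z) \<le> max_degree V E" .
  qed
  have "card (w ` A \<union> F u \<union> F v) \<le> card (w ` A) + card (F u) + card (F v)"
    by (meson add_mono card_Un_le le_refl order_trans)
  also have "\<dots> \<le> card A + max_degree V E + max_degree V E"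
    using F(2) e e2 by (intro add_mono card_image_le insert.hyps) auto
  \<comment> \<open>Strict because \<open>e\<close> lies in \<open>E\<close> but not in
    \<open>A\<close>; this leaves one admissible weight.\<close>
  also have "card A < card E"
    using insert.hyps insert.prems simple_graph_finite_edges[OF G]
    by (intro psubset_card_mono) auto
  finally have "card (w ` A \<union> F u \<union> F v) < card W"
    using W(2) by simp
  then have "\<not> W \<subseteq> w ` A \<union> F u \<union> F v"
    using F(1) insert.hyps by (metis card_mono finite_Un finite_imageI not_le)
  then obtain a where a: "a \<in> W" "a \<notin> w ` A" "a \<notin> F u" "a \<notin> F v" by blast
  let ?w = "w(e := a)"
  have fin: "finite (neighbours A x)" for x
    using finite_subset[OF _ simple_graph_finite_neighbours[OF G, of x], of "neighbours A x"] insert.prems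
    by (auto simp: neighbours_def)
  note sum = weight_sum_insert[OF e2(1) insert.hyps(2) fin, of w a]
  have "edge_weighting (insert e A) W ?w"
    using w(1) a(1) by (auto simp: edge_weighting_def)
  moreover have "edge_injective (insert e A) ?w"
    using w(2) a(2) insert.hyps(2) unfolding edge_injective_def
    by (auto simp: inj_on_def)
  moreover have "weight_sum (insert e A) ?w x \<noteq> weight_sum (insert e A) ?w y"
    if xy: "{x, y} \<in> E" and g: "g \<in> insert e A" "g \<noteq> {x, y}" "g \<inter> {x, y} \<noteq> {}" for x y g
  proof -
    have "x \<noteq> y" using xy G by (auto simp: simple_graph_def dest!: bspec)
    have new: "a \<noteq> ?s q - ?s p" if "{p, q} \<in> E" "p \<in> e" for p q
      using a(3,4) e that by (auto simp: F_def neighbours_def)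
    consider "x \<in> e" "y \<in> e" | "x \<in> e" "y \<notin> e" | "x \<notin> e" "y \<in> e" | "x \<notin> e" "y \<notin> e" by blast
    then show ?thesis
    proof cases
      \<comment> \<open>Both ends gain \<open>a\<close>, so the difference is unchanged; as
        \<open>g\<close> differs from \<open>e\<close>, it was weighted before.\<close>
      case 1
      then have "{x, y} = e" using e \<open>x \<noteq> y\<close> by auto
      then show ?thesis using IH[OF xy _ g(2,3)] g 1 by (auto simp: sum)
    next
      \<comment> \<open>Only one end gains \<open>a\<close>. The choice of \<open>a\<close> decides
        this case alone, even if xy had no weighted adjacent edge before.\<close>
      case 2
      then show ?thesis using new[OF xy] by (auto simp: sum)
    next
      case 3
      then show ?thesis using new[of y x] xy by (auto simp: sum insert_commute)
    next
      \<comment> \<open>Neither sum changes, and \<open>g\<close> meets xy while \<open>e\<close>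
        does not, so \<open>g\<close> was weighted before.\<close>
      case 4
      then have "g \<noteq> e" using g(3) by auto
      then show ?thesis using IH[OF xy _ g(2,3)] g 4 by (auto simp: sum)
    qed
  qed
  ultimately show ?case by blast
qed

theorem theorem4p2:
  fixes V :: "'a set" and E :: "'a set set"
  assumes "simple_graph V E" and "nice V E"
  shows "(\<forall>W :: int set.
            finite W \<and> card W = card E + 2 * max_degree V E \<and> (\<forall>x\<in>W. 0 < x) \<longrightarrow>
            (\<exists>w. edge_weighting E W w \<and> edge_injective E w \<and> neighbour_sum_distinguishing E w))
         \<and> chi_e1_Sigma E \<le> card E + 2 * max_degree V E"
proof -
  have main: "\<exists>w. edge_weighting E W w \<and> edge_injective E w \<and> neighbour_sum_distinguishing E w"
    if W: "finite W" "card W = card E + 2 * max_degree V E" for W :: "int set"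
  proof -
    obtain w where w: "edge_weighting E W w" "edge_injective E w"
      and distinct: "\<And>x y g. {x, y} \<in> E \<Longrightarrow> g \<in> E \<Longrightarrow> g \<noteq> {x, y} \<Longrightarrow> g \<inter> {x, y} \<noteq> {} \<Longrightarrow>
        weight_sum E w x \<noteq> weight_sum E w y"
      using greedy_edge_weighting[OF assms(1) W(1), of E] W(2) by force
    have "neighbour_sum_distinguishing E w"
      unfolding neighbour_sum_distinguishing_def
      using nice_adjacent_edge[OF assms] distinct by metis
    with w show ?thesis by blast
  qed
  moreover have "chi_e1_Sigma E \<le> card E + 2 * max_degree V E"
    \<comment> \<open>Here \<open>W\<close> is the interval from 1 to the claimed bound.\<close>
    unfolding chi_e1_Sigma_def by (rule Least_le) (rule main; simp)
  ultimately show ?thesis by blast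
qed

end
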